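(* Let $q>r\ge2$ be integers and let $n:=rq$. If $e$ is an edge of $K_n^r$, then $K_n^r-e$ has a fractional $K_q^r$-decomposition.
   Context: $K_n^r$ is the complete $r$-uniform hypergraph on $n$ vertices, and $K_n^r-e$ is obtained by deleting the edge $e$ (keeping all vertices). A fractional $K_q^r$-decomposition of an $r$-uniform hypergraph $G$ is an assignment of non-negative real weights to the copies of $K_q^r$ in $G$ such that for every edge $f$ of $G$, the total weight of copies containing $f$ is exactly $1$. *)

theory Defs
  imports Complex_Main "HOL-Library.Ramsey"
begin

datatype 'a hypergraph = Hypergraph (verts: "'a set") (edges: "'a set set")

definition uniform_hypergraph :: "nat \<Rightarrow> 'a hypergraph \<Rightarrow> bool" where
  "uniform_hypergraph r G \<longleftrightarrow> finite (verts G) \<and> edges G \<subseteq> nsets (verts G) r"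

(* G is a K_n^r, on an arbitrary vertex set of size n; nsets V r is the set of
   all r-element subsets of V *)
definition complete_hypergraph :: "nat \<Rightarrow> nat \<Rightarrow> 'a hypergraph \<Rightarrow> bool" where
  "complete_hypergraph n r G \<longleftrightarrow>
     finite (verts G) \<and> card (verts G) = n \<and> edges G = nsets (verts G) r"

definition delete_edge :: "'a hypergraph \<Rightarrow> 'a set \<Rightarrow> 'a hypergraph" where
  "delete_edge G e = Hypergraph (verts G) (edges G - {e})"

definition subhypergraph :: "'a hypergraph \<Rightarrow> 'a hypergraph \<Rightarrow> bool" where
  "subhypergraph H G \<longleftrightarrow> verts H \<subseteq> verts G \<and> edges H \<subseteq> edges G"

(* Copies are unlabelled: each is a subhypergraph of G, not an embedding into G. *)
definition complete_copies :: "nat \<Rightarrow> nat \<Rightarrow> 'a hypergraph \<Rightarrow> 'a hypergraph set" where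
  "complete_copies q r G = {H. subhypergraph H G \<and> complete_hypergraph q r H}"

definition fractional_decomposition ::
    "nat \<Rightarrow> nat \<Rightarrow> 'a hypergraph \<Rightarrow> ('a hypergraph \<Rightarrow> real) \<Rightarrow> bool" where
  "fractional_decomposition q r G w \<longleftrightarrow>
     uniform_hypergraph r G \<and>
     (\<forall>H \<in> complete_copies q r G. w H \<ge> 0) \<and>
     (\<forall>f \<in> edges G. (\<Sum>H | H \<in> complete_copies q r G \<and> f \<in> edges H. w H) = 1)"

(* so the sums above range over finite sets *)
lemma finite_complete_copies:
  assumes "uniform_hypergraph r G"
  shows "finite (complete_copies q r G)"
proof (rule finite_subset)
  show "complete_copies q r G \<subseteq> (\<lambda>S. Hypergraph S (nsets S r)) ` Pow (verts G)"
  proof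
    fix H assume "H \<in> complete_copies q r G"
    then show "H \<in> (\<lambda>S. Hypergraph S (nsets S r)) ` Pow (verts G)"
      by (cases H)
        (auto simp: complete_copies_def subhypergraph_def complete_hypergraph_def)
  qed
  show "finite ((\<lambda>S. Hypergraph S (nsets S r)) ` Pow (verts G))"
    using assms by (simp add: uniform_hypergraph_def)
qed

lemma uniform_hypergraph_delete_edge_complete:
  "complete_hypergraph n r G \<Longrightarrow> uniform_hypergraph r (delete_edge G e)"
  by (auto simp: complete_hypergraph_def uniform_hypergraph_def delete_edge_def)

end

theory Submission
  imports Defs "HOL-Computational_Algebra.Formal_Power_Series"
begin

text \<open>
  By symmetry, let the weight of the copy on \<open>S\<close> depend only on \<open>t = card (e - S)\<close>, which is
  positive because \<open>e\<close> is missing. With \<open>p = q - r\<close>, \<open>N = n - r\<close> and the weights suitably rescaled to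
  \<open>u t\<close>, the condition at an edge \<open>f\<close> with \<open>card (e - f) = k > 0\<close> becomes
  \<open>(\<Sum>t=1..k. (p choose (k - t)) * u t) = (N choose k)\<close>. In terms of generating functions this is
  \<open>(1 + X)^p * U = (1 + X)^N - 1\<close>, so \<open>U = (1 + X)^(N - p) - (1 + X)^(-p)\<close>, that is,
  \<open>u t = ((N - p) choose t) - (-1)^t * ((p + t - 1) choose t)\<close>. This is non-negative
  as soon as \<open>p + t - 1 \<le> N - p\<close>.
\<close>

section \<open>Counting the vertex sets that contain \<open>f\<close> but not
  \<open>e\<close>\<close>

lemma sum_nonempty_subsets_card:
  fixes h :: "nat \<Rightarrow> real"
  assumes "finite D"
  shows "(\<Sum>A \<in> Pow D - {{}}. h (card A)) = (\<Sum>t=1..card D. real (card D choose t) * h t)"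
proof -
  have img: "card ` (Pow D - {{}}) \<subseteq> {1..card D}"
  proof
    fix t assume "t \<in> card ` (Pow D - {{}})"
    then obtain A where A: "A \<subseteq> D" "A \<noteq> {}" "t = card A" by auto
    then have "finite A" using assms finite_subset by auto
    then show "t \<in> {1..card D}"
      using A assms by (auto simp: card_mono Suc_le_eq card_gt_0_iff)
  qed
  have "(\<Sum>A \<in> Pow D - {{}}. h (card A))
      = (\<Sum>t=1..card D. \<Sum>A | A \<in> Pow D - {{}} \<and> card A = t. h (card A))"
    by (rule sum.group[symmetric]) (use assms img in auto)
  also have "\<dots> = (\<Sum>t=1..card D. real (card D choose t) * h t)"
  proof (rule sum.cong[OF refl])
    fix t assume t: "t \<in> {1..card D}"
    then have eq: "{A. A \<in> Pow D - {{}} \<and> card A = t} = {A. A \<subseteq> D \<and> card A = t}"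
      by auto
    show "(\<Sum>A | A \<in> Pow D - {{}} \<and> card A = t. h (card A)) = real (card D choose t) * h t"
      unfolding eq by (simp add: n_subsets[OF assms])
  qed
  finally show ?thesis .
qed

lemma card_Diff_sym:
  assumes "finite e" "finite f" "card e = card f"
  shows "card (e - f) = card (f - e)"
proof -
  have "card e = card (e - f) + card (e \<inter> f)" "card f = card (f - e) + card (e \<inter> f)"
    using assms card_Int_Diff[of e f] card_Int_Diff[of f e] by (auto simp: Int_commute)
  then show ?thesis using assms by simp
qed

text \<open>Bijection: \<open>S\<close> corresponds to the pair of \<open>A = e - S\<close>, a
  nonempty subset of \<open>e - f\<close>, and \<open>B = S - (e \<union> f)\<close>. The size of
  \<open>B\<close> is fixed by that of \<open>A\<close>; writing this as
  \<open>card B + k = p + t\<close> avoids truncated subtraction, and no such \<open>B\<close>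
  exists when \<open>p + t < k\<close>.\<close>

lemma sum_nsets_containing:
  fixes g :: "nat \<Rightarrow> real"
  assumes V: "finite V" and e: "e \<subseteq> V" "card e = r" and f: "f \<subseteq> V" "card f = r"
    and k: "card (e - f) = k"
  shows "(\<Sum>S | S \<in> nsets V (r + p) \<and> f \<subseteq> S \<and> \<not> e \<subseteq> S. g (card (e - S)))
       = (\<Sum>t=1..k. real (k choose t) *
            (real (card {B. B \<subseteq> V - (e \<union> f) \<and> card B + k = p + t}) * g t))"
proof -
  let ?D = "e - f" and ?W = "V - (e \<union> f)"
  let ?B = "\<lambda>t. {B. B \<subseteq> ?W \<and> card B + k = p + t}"
  let ?L = "{S \<in> nsets V (r + p). f \<subseteq> S \<and> \<not> e \<subseteq> S}"
  let ?P = "SIGMA A : Pow ?D - {{}}. ?B (card A)"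
  let ?glue = "\<lambda>(A, B). (e - A) \<union> (f - e) \<union> B"
  let ?split = "\<lambda>S. (e - S, S - (e \<union> f))"
  have fin: "finite e" "finite f" using V e f finite_subset by auto
  have kf: "card (f - e) = k"
    using card_Diff_sym fin e f k by metis
  \<comment> \<open>With glued size \<open>r + p\<close> this reads
    \<open>card B + k = p + card A\<close>, so it serves both directions of the bijection.\<close>
  have card_glue: "card (?glue (A, B)) + card A = r + k + card B"
    if "A \<subseteq> ?D" "B \<subseteq> ?W" for A B
  proof -
    have fAB: "finite A" "finite B" using that V fin by (meson finite_Diff finite_subset)+
    have "card ((e - A) \<union> (f - e) \<union> B) = card ((e - A) \<union> (f - e)) + card B"
      by (rule card_Un_disjoint) (use that fin fAB in auto)
    also have "card ((e - A) \<union> (f - e)) = card (e - A) + card (f - e)"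
      by (rule card_Un_disjoint) (use fin in auto)
    finally have "card ((e - A) \<union> (f - e) \<union> B) = card (e - A) + k + card B"
      using kf by simp
    moreover have "card (e - A) + card A = r"
    proof -
      have "A \<subseteq> e" using that by auto
      then show ?thesis
        using card_Diff_subset[of A e] card_mono[of e A] fAB fin e by simp
    qed
    ultimately show ?thesis by simp
  qed
  have "(\<Sum>S\<in>?L. g (card (e - S))) = (\<Sum>(A, B) \<in> ?P. g (card A))"
  proof (rule sum.reindex_bij_witness[where i = ?glue and j = ?split])
    fix S assume S: "S \<in> ?L"
    then show *: "?glue (?split S) = S" by auto
    have "card S + card (e - S) = r + k + card (S - (e \<union> f))"
      using card_glue[of "e - S" "S - (e \<union> f)"] S * by (auto simp: nsets_def)
    then show "?split S \<in> ?P" using S by (auto simp: nsets_def)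
    show "(case ?split S of (A, B) \<Rightarrow> g (card A)) = g (card (e - S))" by simp
  next
    fix x assume "x \<in> ?P"
    then obtain A B where x: "x = (A, B)" and A: "A \<subseteq> ?D" "A \<noteq> {}"
      and B: "B \<subseteq> ?W" "card B + k = p + card A" by auto
    show "?split (?glue x) = x" using A B x by auto
    have "card (?glue (A, B)) = r + p" using card_glue[OF A(1) B(1)] B(2) by simp
    moreover have "?glue (A, B) \<subseteq> V" using e f B by auto
    moreover have "finite (?glue (A, B))" using calculation V finite_subset by blast
    moreover have "f \<subseteq> ?glue (A, B)" "\<not> e \<subseteq> ?glue (A, B)" using A B by auto
    ultimately show "?glue x \<in> ?L" unfolding x nsets_def by blast
  qed
  also have "\<dots> = (\<Sum>A \<in> Pow ?D - {{}}. \<Sum>B \<in> ?B (card A). g (card A))"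
    by (rule sum.Sigma[symmetric]) (use V fin in auto)
  also have "\<dots> = (\<Sum>A \<in> Pow ?D - {{}}. (\<lambda>t. real (card (?B t)) * g t) (card A))"
    by simp
  also have "\<dots> = (\<Sum>t=1..k. real (k choose t) * (real (card (?B t)) * g t))"
    using sum_nonempty_subsets_card[of ?D "\<lambda>t. real (card (?B t)) * g t"] fin k by simp
  finally show ?thesis .
qed

section \<open>Binomial identities separating \<open>t\<close> from \<open>k\<close>\<close>

text \<open>For \<open>k \<le> m\<close> both sides count pairs of a \<open>k\<close>-set inside an
  \<open>m\<close>-set inside an \<open>N\<close>-set; otherwise both vanish.\<close>

lemma card_subsets_shifted:
  assumes W: "finite W" "card W + k = N" and m: "m \<le> N"
  shows "card {B. B \<subseteq> W \<and> card B + k = m} * (N choose k) = (N choose m) * (m choose k)"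
proof (cases "k \<le> m")
  case True
  then have "{B. B \<subseteq> W \<and> card B + k = m} = {B. B \<subseteq> W \<and> card B = m - k}" by auto
  then have "card {B. B \<subseteq> W \<and> card B + k = m} = (N - k) choose (m - k)"
    using n_subsets[OF W(1)] W(2) by auto
  then show ?thesis using choose_mult[OF True m] by simp
next
  case False
  then have "{B. B \<subseteq> W \<and> card B + k = m} = {}" by auto
  then show ?thesis using False by (simp add: binomial_eq_0)
qed

text \<open>Trades the factor \<open>(p + t) choose k\<close> left by the previous lemma for one
  depending on \<open>t\<close> only, which the weight can absorb, and the convolution kernel
  \<open>p choose (k - t)\<close>.\<close>

lemma choose_mult_shifted:
  assumes "t \<le> k"
  shows "(k choose t) * ((p + t) choose k) = ((p + t) choose t) * (p choose (k - t))"
proof (cases "k \<le> p + t")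
  case True
  then show ?thesis using choose_mult[OF assms True] by (simp add: mult.commute)
next
  case False
  then show ?thesis using assms by (simp add: binomial_eq_0)
qed

section \<open>The weights and their sum at an edge\<close>

text \<open>The coefficient of \<open>X^t\<close> in \<open>(1 + X)^M - (1 + X)^(-p)\<close>, with
  \<open>M\<close> in the role of \<open>N - p\<close>. The negative upper index makes Vandermonde
  applicable directly.\<close>

definition rescaled_weight :: "nat \<Rightarrow> nat \<Rightarrow> nat \<Rightarrow> real" where
  "rescaled_weight M p t = (real M gchoose t) - ((- real p) gchoose t)"

text \<open>Only even \<open>t\<close> is critical; there, after negating the upper index, the
  subtracted binomial has upper index \<open>p + t - 1 \<le> M\<close>.\<close>

lemma rescaled_weight_nonneg:
  assumes "1 \<le> p" "p + t \<le> M + 1"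
  shows "0 \<le> rescaled_weight M p t"
proof -
  have "real p + real t - 1 = real (p + t - 1)" using assms by simp
  then have "(- real p) gchoose t = (- 1) ^ t * real ((p + t - 1) choose t)"
    by (metis gbinomial_minus binomial_gbinomial)
  also have "\<dots> \<le> real ((p + t - 1) choose t)"
    by (cases "even t") auto
  also have "\<dots> \<le> real (M choose t)"
    using assms by (simp add: binomial_right_mono)
  finally show ?thesis by (simp add: rescaled_weight_def binomial_gbinomial)
qed

lemma rescaled_weight_convolution:
  assumes "1 \<le> k"
  shows "(\<Sum>t=1..k. real (p choose (k - t)) * rescaled_weight M p t) = real ((M + p) choose k)"
proof -
  have "(\<Sum>t=1..k. real (p choose (k - t)) * rescaled_weight M p t)
      = (\<Sum>t\<le>k. real (p choose (k - t)) * rescaled_weight M p t)"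
    \<comment> \<open>The added term \<open>t = 0\<close> vanishes, since both generalized binomials
      are 1 there.\<close>
    by (rule sum.mono_neutral_left)
      (auto simp: rescaled_weight_def Suc_le_eq)
  also have "\<dots> = (\<Sum>t\<le>k. (real M gchoose t) * (real p gchoose (k - t)))
               - (\<Sum>t\<le>k. ((- real p) gchoose t) * (real p gchoose (k - t)))"
    by (simp add: rescaled_weight_def binomial_gbinomial algebra_simps sum_subtractf)
  \<comment> \<open>Vandermonde twice; in the second sum the upper indices \<open>-p\<close> and
    \<open>p\<close> cancel, and \<open>0 gchoose k\<close> is 0 because
    \<open>k \<ge> 1\<close>.\<close>
  also have "\<dots> = (real (M + p) gchoose k) - (0 gchoose k)"
    using gbinomial_Vandermonde[of "real M" "real p" k]
      gbinomial_Vandermonde[of "- real p" "real p" k] by (simp add: atLeast0AtMost)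
  also have "\<dots> = real ((M + p) choose k)"
    using assms by (cases k) (auto simp: binomial_gbinomial)
  finally show ?thesis .
qed

text \<open>The denominator cancels the factors depending on \<open>t\<close> alone that the two
  binomial identities produce.\<close>

definition symmetric_weight :: "nat \<Rightarrow> nat \<Rightarrow> nat \<Rightarrow> real" where
  "symmetric_weight N p t =
     rescaled_weight (N - p) p t / (real ((p + t) choose t) * real (N choose (p + t)))"

lemma sum_symmetric_weight:
  assumes V: "finite V" "card V = N + r" and e: "e \<subseteq> V" "card e = r"
    and f: "f \<subseteq> V" "card f = r" "f \<noteq> e" and N: "p + r \<le> N"
  shows "(\<Sum>S | S \<in> nsets V (r + p) \<and> f \<subseteq> S \<and> \<not> e \<subseteq> S. symmetric_weight N p (card (e - S))) = 1"
proof -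
  define k where "k = card (e - f)"
  let ?W = "V - (e \<union> f)"
  have fin: "finite e" "finite f" using V e f finite_subset by auto
  have "\<not> e \<subseteq> f" using card_subset_eq[of f e] fin e f by auto
  then have k1: "1 \<le> k" using fin by (auto simp: k_def Suc_le_eq card_gt_0_iff)
  have kr: "k \<le> r" using e fin by (auto simp: k_def intro: card_mono)
  have "card (e \<union> f) = r + k"
    using card_Un_disjoint[of f "e - f"] fin f k_def by (simp add: Un_commute)
  moreover have "e \<union> f \<subseteq> V" using e f by auto
  ultimately have cW: "card ?W + k = N"
    using V card_Diff_subset[of "e \<union> f" V] card_mono[of V "e \<union> f"] fin by simp
  have summand: "real (k choose t) * (real (card {B. B \<subseteq> ?W \<and> card B + k = p + t})
        * symmetric_weight N p t)
      = real (p choose (k - t)) * rescaled_weight (N - p) p t / real (N choose k)"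
    if t: "t \<in> {1..k}" for t
  proof -
    define c where "c = real (card {B. B \<subseteq> ?W \<and> card B + k = p + t})"
    define u where "u = rescaled_weight (N - p) p t"
    define K m v where "K = real (k choose t)" and "m = real ((p + t) choose k)"
      and "v = real (p choose (k - t))"
    define a b d where "a = real (N choose (p + t))" and "b = real ((p + t) choose t)"
      and "d = real (N choose k)"
    have le: "p + t \<le> N" "k \<le> N" using t kr N by auto
    then have pos: "a > 0" "b > 0" "d > 0"
      by (auto simp: a_def b_def d_def)
    have "finite ?W" using V by simp
    then have cd: "c * d = a * m"
      using card_subsets_shifted[of ?W k N "p + t"] cW le(1)
      unfolding c_def d_def a_def m_def by (simp only: of_nat_mult[symmetric])
    have "t \<le> k" using t by simp
    then have Km: "K * m = b * v"
      using choose_mult_shifted[of t k p]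
      unfolding K_def m_def b_def v_def by (simp only: of_nat_mult[symmetric])
    \<comment> \<open>\<open>m\<close> is eliminated by substitution rather than division, as it is
      0 when \<open>p + t < k\<close>. The remaining denominator \<open>d\<close> does not depend on
      \<open>t\<close>.\<close>
    have "K * c * d = a * (K * m)" using cd by (simp add: algebra_simps)
    then have "K * c * d = a * b * v" using Km by simp
    then have "K * c = a * b * v / d"
      using pos by (simp add: eq_divide_eq)
    then have "K * (c * (u / (b * a))) = a * b * v / d * (u / (b * a))"
      by (simp only: mult.assoc[symmetric])
    also have "\<dots> = v * u / d"
      using pos by simp
    finally show ?thesis
      by (simp only: symmetric_weight_def K_def c_def u_def a_def b_def v_def d_def)
  qed
  have "(\<Sum>S | S \<in> nsets V (r + p) \<and> f \<subseteq> S \<and> \<not> e \<subseteq> S. symmetric_weight N p (card (e - S)))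
      = (\<Sum>t=1..k. real (p choose (k - t)) * rescaled_weight (N - p) p t / real (N choose k))"
    using sum_nsets_containing[OF V(1) e f(1,2) k_def[symmetric]] summand by simp
  also have "\<dots> = real ((N - p + p) choose k) / real (N choose k)"
    using rescaled_weight_convolution[OF k1, of p "N - p"]
    by (simp flip: sum_divide_distrib)
  also have "\<dots> = 1" using N kr by simp
  finally show ?thesis .
qed

section \<open>Copies as vertex sets, and the decomposition\<close>

text \<open>A copy is determined by its vertex set \<open>S\<close>; since \<open>e\<close> has
  \<open>r\<close> elements, it lies in \<open>nsets S r\<close> exactly when
  \<open>e \<subseteq> S\<close>.\<close>

lemma complete_copies_delete_edge:
  assumes "complete_hypergraph n r G" "e \<in> edges G"
  shows "complete_copies q r (delete_edge G e)
       = (\<lambda>S. Hypergraph S (nsets S r)) ` {S \<in> nsets (verts G) q. \<not> e \<subseteq> S}" (is "?L = ?R")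
proof (intro equalityI subsetI)
  fix H assume "H \<in> ?L"
  then show "H \<in> ?R"
    using assms by (cases H)
      (auto simp: complete_copies_def subhypergraph_def complete_hypergraph_def delete_edge_def
         nsets_def image_iff)
next
  fix H assume "H \<in> ?R"
  then obtain S where H: "H = Hypergraph S (nsets S r)"
    and S: "S \<in> nsets (verts G) q" "\<not> e \<subseteq> S" by auto
  have "nsets S r \<subseteq> nsets (verts G) r" using S by (intro nsets_mono) (auto simp: nsets_def)
  moreover have "e \<notin> nsets S r" using S by (auto simp: nsets_def)
  moreover have "S \<subseteq> verts G" "finite S" "card S = q" using S by (auto simp: nsets_def)
  ultimately show "H \<in> ?L"
    using assms(1) H
    by (auto simp: complete_copies_def subhypergraph_def complete_hypergraph_def delete_edge_def)
qed

theorem theorem2p4: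
  fixes q r n :: nat and G :: "'a hypergraph" and e :: "'a set"
  assumes "q > r" and "r \<ge> 2" and "n = r * q"
    and "complete_hypergraph n r G" and "e \<in> edges G"
  shows "\<exists>w. fractional_decomposition q r (delete_edge G e) w"
proof -
  define p where "p = q - r"
  define N where "N = n - r"
  let ?V = "verts G"
  let ?w = "\<lambda>H. symmetric_weight N p (card (e - verts H))"
  let ?K = "\<lambda>S. Hypergraph S (nsets S r)"
  have q: "q = r + p" and p1: "1 \<le> p" using assms p_def by auto
  \<comment> \<open>Here \<open>r \<ge> 2\<close> enters. As \<open>N - p = n - q\<close>, the bound
    gives \<open>q \<le> N - p\<close>, hence \<open>p + t \<le> N - p + 1\<close> for all
    \<open>t \<le> r\<close>, as non-negativity requires.\<close>
  have "2 * q \<le> n" using assms by simp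
  then have Nq: "q \<le> N" "q \<le> N - p + 1" and n: "n = N + r"
    using assms q N_def by auto
  have V: "finite ?V" "card ?V = N + r" and E: "edges G = nsets ?V r"
    using assms n by (auto simp: complete_hypergraph_def)
  have e: "e \<subseteq> ?V" "card e = r" "finite e" using assms(5) E by (auto simp: nsets_def)
  have "fractional_decomposition q r (delete_edge G e) ?w"
    unfolding fractional_decomposition_def
  proof (intro conjI ballI)
    show "uniform_hypergraph r (delete_edge G e)"
      using assms uniform_hypergraph_delete_edge_complete by auto
  next
    fix H
    have "card (e - verts H) \<le> r" using e by (metis card_mono Diff_subset)
    then show "0 \<le> ?w H"
      unfolding symmetric_weight_def
      using rescaled_weight_nonneg[OF p1] Nq q by (intro divide_nonneg_nonneg) auto
  next
    fix f assume "f \<in> edges (delete_edge G e)"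
    then have f: "f \<subseteq> ?V" "card f = r" "f \<noteq> e" "finite f"
      using E by (auto simp: delete_edge_def nsets_def)
    have f_iff: "f \<in> edges (?K S) \<longleftrightarrow> f \<subseteq> S" for S using f by (simp add: nsets_def)
    have copies: "{H \<in> complete_copies q r (delete_edge G e). f \<in> edges H}
        = ?K ` {S \<in> nsets ?V (r + p). f \<subseteq> S \<and> \<not> e \<subseteq> S}"
      unfolding complete_copies_delete_edge[OF assms(4,5)] q
      using f_iff by blast
    have "inj_on ?K {S \<in> nsets ?V (r + p). f \<subseteq> S \<and> \<not> e \<subseteq> S}"
      by (auto intro: inj_onI)
    then show "(\<Sum>H | H \<in> complete_copies q r (delete_edge G e) \<and> f \<in> edges H. ?w H) = 1"
      using sum_symmetric_weight[OF V e(1,2) f(1,2,3)] Nq q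
      unfolding copies by (simp add: sum.reindex)
  qed
  then show ?thesis by blast
qed

end
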